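(* Let $C$ be a nonempty closed convex subset of a real Hilbert space $H$. Let $T:C\to C$ be a $\kappa$-strict pseudo-contraction for some $0\le\kappa<1$ such that $F(T)\ne\emptyset$, and let $L$ be a Lipschitz constant of $T$. Suppose $\{\alpha_n\}_{n\ge0}$ and $\{\beta_n\}_{n\ge0}$ are two real sequences in $[0,1]$ satisfying $0<\alpha\le\alpha_n\le1$ (for some constant $\alpha$) and $0\le\beta_n\le\kappa\alpha_n+(1-\kappa)$ for all $n$. Let $x_0\in C$ be arbitrary and let $\{x_n\}$ be generated, for $n\ge0$, by $$v_n=(1-\alpha_n)x_n+\alpha_nTx_n,\qquad y_n=(1-\beta_n)x_n+\beta_nTv_n,$$ $$C_n'=\{z\in C:\|v_n-z\|^2\le\|x_n-z\|^2+\alpha_n(\kappa-(1-\alpha_n))\|x_n-Tx_n\|^2\},$$ $$C_n''=\{z\in C:\|y_n-z\|^2\le\|x_n-z\|^2-\alpha_n\beta_n(1-(\kappa+1)\alpha_n-\kappa L^2\alpha_n^2)\|x_n-Tx_n\|^2\},$$ $$C_n=C_n'\cap C_n'',$$ $$Q_n=\{z\in C:\langle z-x_n,x_n-x_0\rangle\ge0\},$$ $$x_{n+1}=P_{C_n^*\cap Q_n}x_0,$$ where $C_n^*$ is a closed convex set with $F(T)\subset C_n^*\subset C_n$. Then $\{x_n\}$ converges strongly to $P_{F(T)}x_0$.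
   Context: $F(T)=\{x\in C:Tx=x\}$. $T$ is a $\kappa$-strict pseudo-contraction if $\|Tx-Ty\|^2\le\|x-y\|^2+\kappa\|(I-T)x-(I-T)y\|^2$ for all $x,y\in C$ ($I$ the identity); such a mapping is Lipschitz. $L$ is a Lipschitz constant of $T$ if $\|Tx-Ty\|\le L\|x-y\|$ for all $x,y\in C$. For a nonempty closed convex set $D\subset H$, $P_D$ is the metric projection (nearest-point map) onto $D$. *)

theory Defs
  imports "HOL-Analysis.Analysis"
begin

definition fixed_points :: "'a set \<Rightarrow> ('a \<Rightarrow> 'a) \<Rightarrow> 'a set" where
  "fixed_points C T = {x \<in> C. T x = x}"

definition strict_pseudo_contraction_on ::
    "real \<Rightarrow> 'a::real_normed_vector set \<Rightarrow> ('a \<Rightarrow> 'a) \<Rightarrow> bool" where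
  "strict_pseudo_contraction_on \<kappa> C T \<longleftrightarrow>
     (\<forall>x\<in>C. \<forall>y\<in>C.
        (norm (T x - T y))\<^sup>2 \<le> (norm (x - y))\<^sup>2 + \<kappa> * (norm ((x - T x) - (y - T y)))\<^sup>2)"

(* The library's closest_point is restricted to the class heine_borel and hence to finite
   dimension.  In a Hilbert space the description below is proper whenever D is nonempty,
   closed and convex; for other D the value may be unspecified. *)
definition metric_projection :: "'a::metric_space set \<Rightarrow> 'a \<Rightarrow> 'a" where
  "metric_projection D x = (THE p. p \<in> D \<and> (\<forall>z\<in>D. dist x p \<le> dist x z))"

end

theory Submission
  imports Defs
begin

text \<open>
  Strong convergence comes from comparing the iterates with Browder's approximants, which converge
  in norm to the projection of \<open>x0\<close> onto the fixed point set.

  Averaging a \<open>\<kappa>\<close>-strict pseudo-contraction \<open>T\<close> with the identity gives a nonexpansive map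
  \<open>S p = \<kappa> p + (1 - \<kappa>) T p\<close> with the same fixed points
  (\<open>averaged_strict_pseudo_contraction_nonexpansive\<close>). For \<open>s > 0\<close> the equation
  \<open>w - S w = s (x0 - w)\<close> has a solution by Banach's fixed point theorem. Since \<open>I - S\<close> is
  monotone, solutions \<open>p\<close>, \<open>q\<close> for parameters \<open>s < t\<close> satisfy
  \<open>norm (p - q)^2 \<le> norm (p - x0)^2 - norm (q - x0)^2\<close> (\<open>regularized_fixed_point_distance\<close>).
  Hence the solutions \<open>W k\<close> for \<open>s = 1 / (k + 1)\<close> form a Cauchy sequence. Taking \<open>s = 0\<close>, where
  the solutions are the fixed points, shows that the limit is the fixed point
  nearest to \<open>x0\<close> (\<open>Browder_approximants_converge\<close>).

  The same monotonicity almost applies when \<open>p\<close> is only an approximate fixed point. It follows that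
  any sequence in \<open>C\<close> with \<open>x n - S (x n) \<longlonglongrightarrow> 0\<close> and
  \<open>norm (x n - x0) \<le> norm (q - x0)\<close> for all fixed points \<open>q\<close> converges to that nearest fixed point
  (\<open>approximate_fixed_points_converge_to_projection\<close>).

  The hybrid method produces such a sequence. Inductively, the variational inequality for the
  projection puts all fixed points into every \<open>Q n\<close>. As \<open>x n\<close> is the point of \<open>Q n\<close> nearest to
  \<open>x0\<close>, this gives the distance bound. As \<open>x (Suc n)\<close> lies in \<open>Q n\<close>, the
  squared distances to \<open>x0\<close> increase by at least the squared step lengths, so the steps tend to \<open>0\<close>.
  Membership of \<open>x (Suc n)\<close> in \<open>C' n\<close> bounds \<open>norm (x n - S (x n))\<close> by twice the step length.
\<close>

section \<open>Identities in inner product spaces\<close>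

lemma norm_diff_scaleR_square:
  fixes u d :: "'a::real_inner"
  shows "(norm (u - c *\<^sub>R d))\<^sup>2 = (norm u)\<^sup>2 - 2 * (c * inner u d) + c\<^sup>2 * (norm d)\<^sup>2"
  unfolding power2_norm_eq_inner
  by (simp add: inner_diff_left inner_diff_right inner_commute power2_eq_square)

text \<open>
  If \<open>inner (z - p) (p - x) \<ge> 0\<close>, the case of a projection \<open>p\<close> of \<open>x\<close>, this law of cosines
  controls \<open>norm (z - p)\<close> by a gap between distances to \<open>x\<close>. The estimates below all
  have this form.
\<close>

lemma norm_diff_square_via:
  fixes z p x :: "'a::real_inner"
  shows "(norm (z - p))\<^sup>2 = (norm (z - x))\<^sup>2 - (norm (p - x))\<^sup>2 - 2 * inner (z - p) (p - x)"
  using norm_diff_scaleR_square[of "z - p" "- 1" "p - x"] by simp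

section \<open>Metric projection in Hilbert spaces\<close>

text \<open>
  By the parallelogram law two points of \<open>D\<close> whose distance to \<open>x\<close> is almost minimal are close
  to each other, because their midpoint stays in \<open>D\<close>. The almost minimizing points thus form nested
  closed sets of vanishing diameter, and completeness gives a common point.
\<close>

lemma nearest_point_exists:
  fixes D :: "'a::{real_inner, complete_space} set"
  assumes "closed D" "convex D" "D \<noteq> {}"
  obtains p where "p \<in> D" "\<And>z. z \<in> D \<Longrightarrow> dist x p \<le> dist x z"
proof -
  define d where "d = infdist x D"
  define A where "A = (\<lambda>n. D \<inter> cball x (d + inverse (real (Suc n))))"
  have d: "0 \<le> d" "\<And>z. z \<in> D \<Longrightarrow> d \<le> dist x z"
    by (auto simp: d_def infdist_nonneg infdist_le)
  obtain p where p: "\<And>n. p \<in> A n"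
  proof (rule decreasing_closed_nest)
    show "closed (A n)" for n by (simp add: A_def assms(1) closed_Int)
    show "A n \<noteq> {}" for n
    proof -
      have "(INF z\<in>D. dist x z) < d + inverse (real (Suc n))"
        using infdist_notempty[OF assms(3), of x] by (simp add: d_def)
      then obtain z where "z \<in> D" "dist x z < d + inverse (real (Suc n))"
        using cINF_less_iff[OF assms(3) bdd_belowI2[of D 0 "dist x"]] by auto
      then show ?thesis unfolding A_def by (auto intro: less_imp_le)
    qed
    show "A n \<subseteq> A m" if "m \<le> n" for m n
    proof -
      have "inverse (real (Suc n)) \<le> inverse (real (Suc m))"
        using that by (intro le_imp_inverse_le) auto
      then have "cball x (d + inverse (real (Suc n))) \<subseteq> cball x (d + inverse (real (Suc m)))"
        by (intro subset_cball) simp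
      then show ?thesis unfolding A_def by blast
    qed
    fix e :: real assume "e > 0"
    \<comment> \<open>By the parallelogram law, this sequence bounds the squared diameters of the sets \<open>A n\<close>.\<close>
    have "(\<lambda>n. 4 * (d + inverse (real (Suc n)))\<^sup>2 - 4 * d\<^sup>2) \<longlonglongrightarrow> 4 * (d + 0)\<^sup>2 - 4 * d\<^sup>2"
      by (intro tendsto_intros LIMSEQ_inverse_real_of_nat)
    then have "\<forall>\<^sub>F n in sequentially. 4 * (d + inverse (real (Suc n)))\<^sup>2 - 4 * d\<^sup>2 < e\<^sup>2"
      by (rule order_tendstoD(2)) (use \<open>e > 0\<close> in simp)
    then obtain n where n: "4 * (d + inverse (real (Suc n)))\<^sup>2 - 4 * d\<^sup>2 < e\<^sup>2"
      unfolding eventually_sequentially by blast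
    have "dist p q < e" if "p \<in> A n" "q \<in> A n" for p q
    proof -
      define r where "r = d + inverse (real (Suc n))"
      have "norm (p - x) \<le> r" "norm (q - x) \<le> r"
        using that by (auto simp: A_def r_def dist_norm norm_minus_commute)
      then have sq: "(norm (p - x))\<^sup>2 \<le> r\<^sup>2" "(norm (q - x))\<^sup>2 \<le> r\<^sup>2"
        by (auto intro: power_mono)
      define c where "c = (1 / 2) *\<^sub>R p + (1 / 2) *\<^sub>R q"
      have "c \<in> D" using that convexD[OF assms(2), of p q "1/2" "1/2"] by (auto simp: A_def c_def)
      then have "d \<le> norm (c - x)" using d(2)[of c] by (simp add: dist_norm norm_minus_commute)
      then have "d\<^sup>2 \<le> (norm (c - x))\<^sup>2" using d(1) by (intro power_mono)
      moreover have "(norm (p - q))\<^sup>2 = 2 * (norm (p - x))\<^sup>2 + 2 * (norm (q - x))\<^sup>2 - 4 * (norm (c - x))\<^sup>2"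
      proof -
        have "2 *\<^sub>R (c - x) = (p - x) + (q - x)"
          by (simp add: c_def scaleR_add_right scaleR_diff_right scaleR_2)
        then have "(norm (2 *\<^sub>R (c - x)))\<^sup>2 = (norm ((p - x) + (q - x)))\<^sup>2" by simp
        then have "4 * (norm (c - x))\<^sup>2 = (norm ((p - x) + (q - x)))\<^sup>2"
          by (simp add: power2_eq_square)
        moreover have "(norm (p - q))\<^sup>2 + (norm ((p - x) + (q - x)))\<^sup>2
            = 2 * (norm (p - x))\<^sup>2 + 2 * (norm (q - x))\<^sup>2"
          using dot_norm[of "p - x" "q - x"] dot_norm_neg[of "p - x" "q - x"] by simp
        ultimately show ?thesis by linarith
      qed
      ultimately have "(norm (p - q))\<^sup>2 < e\<^sup>2" using sq n unfolding r_def by linarith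
      then show ?thesis using \<open>e > 0\<close> by (simp add: dist_norm power2_less_imp_less)
    qed
    then show "\<exists>n. \<forall>p\<in>A n. \<forall>q\<in>A n. dist p q < e" by blast
  qed blast
  have "(\<lambda>n. d + inverse (real (Suc n))) \<longlonglongrightarrow> d + 0"
    by (intro tendsto_intros LIMSEQ_inverse_real_of_nat)
  then have "dist x p \<le> d + 0"
    by (rule LIMSEQ_le_const) (use p in \<open>auto simp: A_def\<close>)
  then show thesis using that[of p] p d(2) by (force simp: A_def)
qed

text \<open>
  The quantitative form of minimality yields uniqueness at once: another minimizer \<open>r\<close> makes the
  right-hand side nonpositive. Besides closed convex sets, this serves to identify the
  projection onto a fixed point set.
\<close>

lemma metric_projection_eqI:
  assumes "p \<in> D" "\<And>z. z \<in> D \<Longrightarrow> (norm (z - p))\<^sup>2 \<le> (norm (z - x0))\<^sup>2 - (norm (p - x0))\<^sup>2"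
  shows "metric_projection D x0 = p"
  unfolding metric_projection_def
proof (rule the_equality)
  have "dist x0 p \<le> dist x0 z" if "z \<in> D" for z
  proof -
    have "(norm (p - x0))\<^sup>2 \<le> (norm (z - x0))\<^sup>2"
      using assms(2)[OF that] zero_le_power2[of "norm (z - p)"] by linarith
    then show ?thesis by (simp add: dist_norm norm_minus_commute power2_le_iff_abs_le)
  qed
  then show "p \<in> D \<and> (\<forall>z\<in>D. dist x0 p \<le> dist x0 z)" using assms(1) by blast
next
  fix r assume r: "r \<in> D \<and> (\<forall>z\<in>D. dist x0 r \<le> dist x0 z)"
  then have "norm (r - x0) \<le> norm (p - x0)"
    using assms(1) by (simp add: dist_norm norm_minus_commute)
  then have "(norm (r - x0))\<^sup>2 \<le> (norm (p - x0))\<^sup>2" by (simp add: power_mono)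
  moreover have "(norm (r - p))\<^sup>2 \<le> (norm (r - x0))\<^sup>2 - (norm (p - x0))\<^sup>2"
    using assms(2) r by blast
  ultimately have "(norm (r - p))\<^sup>2 \<le> 0" by linarith
  then show "r = p" by simp
qed

lemma metric_projection_characterization:
  fixes D :: "'a::{real_inner, complete_space} set"
  assumes "closed D" "convex D" "D \<noteq> {}"
  shows "metric_projection D x \<in> D"
    and "z \<in> D \<Longrightarrow> inner (z - metric_projection D x) (metric_projection D x - x) \<ge> 0"
proof -
  obtain p where p: "p \<in> D" "\<And>z. z \<in> D \<Longrightarrow> dist x p \<le> dist x z"
    using nearest_point_exists[OF assms] by blast
  have var: "inner (z - p) (p - x) \<ge> 0" if "z \<in> D" for z
    using any_closest_point_dot[OF assms(2,1) p(1) that, of x] p(2)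
    by (auto simp: inner_diff_left inner_diff_right inner_commute algebra_simps)
  have "metric_projection D x = p"
  proof (rule metric_projection_eqI[OF p(1)])
    fix z assume "z \<in> D"
    from var[OF this] show "(norm (z - p))\<^sup>2 \<le> (norm (z - x))\<^sup>2 - (norm (p - x))\<^sup>2"
      using norm_diff_square_via[of z p x] by simp
  qed
  then show "metric_projection D x \<in> D"
    and "z \<in> D \<Longrightarrow> inner (z - metric_projection D x) (metric_projection D x - x) \<ge> 0"
    using p(1) var by auto
qed

section \<open>Nonexpansive maps and monotone displacements\<close>

text \<open>
  Displacement maps \<open>p - S p\<close> of nonexpansive maps are monotone operators; by Cauchy-Schwarz,
  \<open>S\<close> cannot move two points apart in the direction of their difference.
\<close>

lemma displacement_monotone:
  fixes p q :: "'a::real_inner"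
  assumes "norm (S p - S q) \<le> norm (p - q)"
  shows "inner ((p - S p) - (q - S q)) (p - q) \<ge> 0"
proof -
  have "inner (S p - S q) (p - q) \<le> norm (S p - S q) * norm (p - q)"
    by (rule norm_cauchy_schwarz)
  also have "\<dots> \<le> norm (p - q) * norm (p - q)"
    using assms by (simp add: mult_right_mono)
  also have "\<dots> = inner (p - q) (p - q)"
    by (simp add: dot_square_norm power2_eq_square)
  finally show ?thesis
    by (simp add: inner_diff_left)
qed

text \<open>
  With \<open>u = p - q\<close> and \<open>d\<close> the difference of the displacements under \<open>T\<close>, the hypothesis
  says exactly \<open>(1 - \<kappa>) * norm d ^ 2 \<le> 2 * inner u d\<close>. This in turn is, for \<open>\<kappa> < 1\<close>, exactly the
  nonexpansiveness of the average with weight \<open>1 - \<kappa>\<close>.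
\<close>

lemma averaged_strict_pseudo_contraction_nonexpansive:
  fixes T :: "'a::real_inner \<Rightarrow> 'a"
  assumes "strict_pseudo_contraction_on \<kappa> C T" "\<kappa> < 1" "p \<in> C" "q \<in> C"
  shows "norm ((\<kappa> *\<^sub>R p + (1 - \<kappa>) *\<^sub>R T p) - (\<kappa> *\<^sub>R q + (1 - \<kappa>) *\<^sub>R T q)) \<le> norm (p - q)"
proof -
  define u d where "u = p - q" and "d = (p - T p) - (q - T q)"
  have T_diff: "T p - T q = u - d"
    by (simp add: u_def d_def algebra_simps)
  have "(norm (u - d))\<^sup>2 \<le> (norm u)\<^sup>2 + \<kappa> * (norm d)\<^sup>2"
    using assms T_diff unfolding strict_pseudo_contraction_on_def u_def d_def by metis
  then have "(1 - \<kappa>) * (norm d)\<^sup>2 \<le> 2 * inner u d"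
    using norm_diff_scaleR_square[of u 1 d] by (simp add: left_diff_distrib)
  then have "(1 - \<kappa>) * ((1 - \<kappa>) * (norm d)\<^sup>2) \<le> (1 - \<kappa>) * (2 * inner u d)"
    using assms(2) by (intro mult_left_mono) auto
  then have "(norm (u - (1 - \<kappa>) *\<^sub>R d))\<^sup>2 \<le> (norm u)\<^sup>2"
    unfolding norm_diff_scaleR_square by (simp add: power2_eq_square mult.assoc mult.left_commute)
  moreover have "(\<kappa> *\<^sub>R p + (1 - \<kappa>) *\<^sub>R T p) - (\<kappa> *\<^sub>R q + (1 - \<kappa>) *\<^sub>R T q)
      = u - (1 - \<kappa>) *\<^sub>R d"
    by (simp add: u_def d_def algebra_simps)
  ultimately show ?thesis
    by (auto simp: u_def intro: power2_le_imp_le)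
qed

section \<open>Regularized fixed points\<close>

text \<open>
  Solved for \<open>w\<close>, the equation reads \<open>w = (s x0 + S w) / (1 + s)\<close>, and the right-hand side is a
  contraction of \<open>C\<close> with constant \<open>1 / (1 + s)\<close>.
\<close>

lemma regularized_fixed_point_exists:
  fixes S :: "'a::{real_inner, complete_space} \<Rightarrow> 'a"
  assumes "closed C" "convex C" "S ` C \<subseteq> C" "x0 \<in> C" "s > 0"
    and nonexp: "\<And>p q. p \<in> C \<Longrightarrow> q \<in> C \<Longrightarrow> norm (S p - S q) \<le> norm (p - q)"
  shows "\<exists>w\<in>C. w - S w = s *\<^sub>R (x0 - w)"
proof -
  define c where "c = 1 / (1 + s)"
  have c: "0 \<le> c" "c < 1" "c * s = 1 - c" "c * (1 + s) = 1"
    using assms(5) by (auto simp: c_def field_simps)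
  define f where "f = (\<lambda>z. (1 - c) *\<^sub>R x0 + c *\<^sub>R S z)"
  have "\<exists>!w\<in>C. f w = w"
  proof (rule Banach_fix)
    show "complete C" using assms(1) by (simp add: complete_eq_closed)
    show "C \<noteq> {}" using assms(4) by auto
    show "f ` C \<subseteq> C"
    proof
      fix r assume "r \<in> f ` C"
      then obtain z where "z \<in> C" "r = f z" by auto
      then show "r \<in> C"
        using assms(3) convexD[OF assms(2,4), of "S z" "1 - c" c] c by (auto simp: f_def)
    qed
    show "dist (f p) (f q) \<le> c * dist p q" if "p \<in> C" "q \<in> C" for p q
    proof -
      have "f p - f q = c *\<^sub>R (S p - S q)" by (simp add: f_def algebra_simps)
      then show ?thesis using nonexp[OF that] c by (simp add: dist_norm mult_left_mono)
    qed
  qed (use c in auto)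
  then obtain w where w: "w \<in> C" "f w = w" by auto
  have "(1 + s) *\<^sub>R w = (1 + s) *\<^sub>R f w" using w by simp
  also have "\<dots> = ((1 + s) * (1 - c)) *\<^sub>R x0 + ((1 + s) * c) *\<^sub>R S w"
    by (simp add: f_def scaleR_add_right)
  also have "\<dots> = s *\<^sub>R x0 + S w"
    using c by (simp add: algebra_simps)
  finally have "w - S w = s *\<^sub>R (x0 - w)" by (simp add: algebra_simps)
  with w show ?thesis by blast
qed

text \<open>
  Monotonicity of the displacement, applied to \<open>p\<close> and \<open>q\<close>, forces
  \<open>inner (q - x0) (p - q) \<ge> 0\<close>: the angle at \<open>q\<close> between \<open>x0\<close> and \<open>p\<close> is not acute. The parameter
  \<open>s = 0\<close> is admitted so that \<open>p\<close> may be a genuine fixed point.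
\<close>

lemma regularized_fixed_point_distance:
  fixes p q x0 :: "'a::real_inner"
  assumes "norm (S p - S q) \<le> norm (p - q)" "0 \<le> s" "s < t"
    and p: "p - S p = s *\<^sub>R (x0 - p)" and q: "q - S q = t *\<^sub>R (x0 - q)"
  shows "(norm (p - q))\<^sup>2 \<le> (norm (p - x0))\<^sup>2 - (norm (q - x0))\<^sup>2"
proof -
  define D e where "D = p - q" and "e = q - x0"
  have pe: "p - x0 = e + D" by (simp add: D_def e_def)
  have "s *\<^sub>R (x0 - p) - t *\<^sub>R (x0 - q) = t *\<^sub>R e - s *\<^sub>R (e + D)"
    by (simp add: D_def e_def algebra_simps)
  with displacement_monotone[OF assms(1)] p q
  have "inner (t *\<^sub>R e - s *\<^sub>R (e + D)) D \<ge> 0" by (simp add: D_def)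
  then have "(t - s) * inner e D \<ge> s * inner D D"
    by (simp add: inner_diff_left inner_add_left algebra_simps)
  then have "(t - s) * inner e D \<ge> 0"
    using assms(2) by (meson inner_ge_zero mult_nonneg_nonneg order_trans)
  then have "inner e D \<ge> 0"
    using assms(3) by (simp add: zero_le_mult_iff)
  then have "(norm D)\<^sup>2 \<le> (norm (e + D))\<^sup>2 - (norm e)\<^sup>2"
    unfolding power2_norm_eq_inner
    by (simp add: inner_add_left inner_add_right inner_commute)
  then show ?thesis by (simp add: pe[symmetric] D_def[symmetric] e_def[symmetric])
qed

text \<open>
  A version of the previous estimate with an arbitrary \<open>p\<close> in place of a fixed point; the price is
  an error term proportional to the displacement of \<open>p\<close>.
\<close>

lemma approximate_fixed_point_distance:
  fixes p q x0 :: "'a::real_inner"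
  assumes "norm (S p - S q) \<le> norm (p - q)" "t > 0" "q - S q = t *\<^sub>R (x0 - q)"
  shows "(norm (p - q))\<^sup>2
    \<le> (norm (p - x0))\<^sup>2 - (norm (q - x0))\<^sup>2 + 2 / t * (norm (p - S p) * norm (p - q))"
proof -
  have "t * inner (x0 - q) (p - q) \<le> inner (p - S p) (p - q)"
    using displacement_monotone[OF assms(1)] assms(3) by (simp add: inner_diff_left)
  also have "\<dots> \<le> norm (p - S p) * norm (p - q)" by (rule norm_cauchy_schwarz)
  finally have "2 * inner (x0 - q) (p - q) \<le> 2 / t * (norm (p - S p) * norm (p - q))"
    using assms(2) by (simp add: field_simps)
  moreover have "(norm (p - q))\<^sup>2
      = (norm (p - x0))\<^sup>2 - (norm (q - x0))\<^sup>2 + 2 * inner (x0 - q) (p - q)"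
  proof -
    have "inner (x0 - q) (p - q) = - inner (p - q) (q - x0)"
      by (metis inner_commute inner_minus_left minus_diff_eq)
    then show ?thesis using norm_diff_square_via[of p q x0] by simp
  qed
  ultimately show ?thesis by simp
qed

lemma Cauchy_if_distance_bounded_by_increment:
  fixes W :: "nat \<Rightarrow> 'a::real_normed_vector"
  assumes incr: "\<And>m n. m \<le> n \<Longrightarrow> (norm (W n - W m))\<^sup>2 \<le> g n - g m"
    and bound: "\<And>n. g n \<le> (B::real)"
  shows "Cauchy W"
proof (rule CauchyI')
  fix e :: real assume "e > 0"
  have "g m \<le> g n" if "m \<le> n" for m n
    using order_trans[OF zero_le_power2 incr[OF that]] by simp
  then have "incseq g" by (simp add: incseq_def)
  then obtain l where "g \<longlonglongrightarrow> l" using incseq_convergent bound by blast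
  then have "Cauchy g" by (rule LIMSEQ_imp_Cauchy)
  then obtain M where M: "\<And>m n. m \<ge> M \<Longrightarrow> n \<ge> M \<Longrightarrow> dist (g m) (g n) < e\<^sup>2"
    using \<open>e > 0\<close> unfolding Cauchy_def by (metis zero_less_power)
  have "dist (W m) (W n) < e" if "m \<ge> M" "n > m" for m n
  proof -
    have "(norm (W n - W m))\<^sup>2 < e\<^sup>2"
      using incr[of m n] M[of m n] that by (auto simp: dist_real_def)
    then show ?thesis
      using \<open>e > 0\<close> by (simp add: dist_norm norm_minus_commute power2_less_imp_less)
  qed
  then show "\<exists>M. \<forall>m\<ge>M. \<forall>n>m. dist (W m) (W n) < e" by blast
qed

text \<open>
  Browder's theorem on the strong convergence of regularized fixed points. The distances of
  \<open>W k\<close> to \<open>x0\<close> are bounded by that of any fixed point, and their squares increase by at least the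
  squared distances between the approximants, so these form a Cauchy sequence.
\<close>

lemma Browder_approximants_converge:
  fixes S :: "'a::{real_inner, complete_space} \<Rightarrow> 'a"
  assumes "closed C" "convex C" "S ` C \<subseteq> C" "x0 \<in> C" "fixed_points C S \<noteq> {}"
    and nonexp: "\<And>p q. p \<in> C \<Longrightarrow> q \<in> C \<Longrightarrow> norm (S p - S q) \<le> norm (p - q)"
  obtains W w where "\<And>k. W k \<in> C"
    "\<And>k. W k - S (W k) = inverse (real (Suc k)) *\<^sub>R (x0 - W k)"
    "W \<longlonglongrightarrow> w" "w \<in> fixed_points C S"
    "\<And>q. q \<in> fixed_points C S \<Longrightarrow> (norm (q - w))\<^sup>2 \<le> (norm (q - x0))\<^sup>2 - (norm (w - x0))\<^sup>2"
proof -
  have "\<forall>k. \<exists>w\<in>C. w - S w = inverse (real (Suc k)) *\<^sub>R (x0 - w)"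
    by (intro allI regularized_fixed_point_exists assms) auto
  then obtain W where WC: "\<And>k. W k \<in> C"
    and W: "\<And>k. W k - S (W k) = inverse (real (Suc k)) *\<^sub>R (x0 - W k)"
    by metis
  \<comment> \<open>A fixed point solves the regularized equation with parameter \<open>0\<close>.\<close>
  have fixed_dist: "(norm (q - W k))\<^sup>2 \<le> (norm (q - x0))\<^sup>2 - (norm (W k - x0))\<^sup>2"
    if "q \<in> fixed_points C S" for q k
    using that WC[of k] W[of k]
    by (intro regularized_fixed_point_distance[where S = S and s = 0 and t = "inverse (real (Suc k))"]
        nonexp) (auto simp: fixed_points_def)
  obtain q0 where q0: "q0 \<in> fixed_points C S" using assms(5) by auto
  have bound: "(norm (W k - x0))\<^sup>2 \<le> (norm (q0 - x0))\<^sup>2" for k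
    using fixed_dist[OF q0, of k] zero_le_power2[of "norm (q0 - W k)"] by linarith
  have "Cauchy W"
  proof (rule Cauchy_if_distance_bounded_by_increment[OF _ bound])
    fix m n :: nat assume "m \<le> n"
    show "(norm (W n - W m))\<^sup>2 \<le> (norm (W n - x0))\<^sup>2 - (norm (W m - x0))\<^sup>2"
    proof (cases "m = n")
      case False
      with \<open>m \<le> n\<close> have "inverse (real (Suc n)) < inverse (real (Suc m))"
        by (intro less_imp_inverse_less) auto
      then show ?thesis
        by (intro regularized_fixed_point_distance[where S = S, OF nonexp[OF WC WC] _ _ W[of n] W[of m]])
          auto
    qed simp
  qed
  then obtain w where lim: "W \<longlonglongrightarrow> w" using Cauchy_convergent_iff convergent_def by blast
  have wC: "w \<in> C" using closed_sequentially[OF assms(1) _ lim] WC by blast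
  have "(\<lambda>k. inverse (real (Suc k)) *\<^sub>R (x0 - W k)) \<longlonglongrightarrow> 0 *\<^sub>R (x0 - w)"
    by (intro tendsto_intros LIMSEQ_inverse_real_of_nat lim)
  then have "(\<lambda>k. W k - (W k - S (W k))) \<longlonglongrightarrow> w - 0"
    unfolding W[symmetric] by (intro tendsto_diff lim) simp
  then have SW: "(\<lambda>k. S (W k)) \<longlonglongrightarrow> w" by simp
  have "(\<lambda>k. norm (W k - w)) \<longlonglongrightarrow> 0"
    using lim by (simp add: LIM_zero_iff tendsto_norm_zero_iff)
  then have "(\<lambda>k. norm (S (W k) - S w)) \<longlonglongrightarrow> 0"
    by (rule Lim_null_comparison[rotated]) (use nonexp WC wC in auto)
  then have "(\<lambda>k. S (W k)) \<longlonglongrightarrow> S w"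
    by (simp add: LIM_zero_iff tendsto_norm_zero_iff)
  with SW have "S w = w" using LIMSEQ_unique by blast
  with wC have "w \<in> fixed_points C S" by (simp add: fixed_points_def)
  moreover have "(norm (q - w))\<^sup>2 \<le> (norm (q - x0))\<^sup>2 - (norm (w - x0))\<^sup>2"
    if "q \<in> fixed_points C S" for q
  proof (rule LIMSEQ_le)
    show "(\<lambda>k. (norm (q - W k))\<^sup>2) \<longlonglongrightarrow> (norm (q - w))\<^sup>2" by (intro tendsto_intros lim)
    show "(\<lambda>k. (norm (q - x0))\<^sup>2 - (norm (W k - x0))\<^sup>2)
        \<longlonglongrightarrow> (norm (q - x0))\<^sup>2 - (norm (w - x0))\<^sup>2"
      by (intro tendsto_intros lim)
  qed (use fixed_dist[OF that] in blast)
  ultimately show thesis using that WC W lim by blast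
qed

section \<open>Approximate fixed points near the base point\<close>

text \<open>
  This does the work of weak compactness, demiclosedness of \<open>I - S\<close> and weak lower semicontinuity
  of the norm in the classical argument. For a fixed approximant \<open>W k\<close>, the distance of \<open>x n\<close> to \<open>W k\<close>
  is eventually small because \<open>norm (x n - x0)\<close> does not exceed \<open>norm (w - x0)\<close>, which is
  only slightly larger than \<open>norm (W k - x0)\<close>.
\<close>

lemma approximate_fixed_points_converge_to_projection:
  fixes S :: "'a::{real_inner, complete_space} \<Rightarrow> 'a"
  assumes "closed C" "convex C" "S ` C \<subseteq> C" "x0 \<in> C" "fixed_points C S \<noteq> {}"
    and nonexp: "\<And>p q. p \<in> C \<Longrightarrow> q \<in> C \<Longrightarrow> norm (S p - S q) \<le> norm (p - q)"
    and xC: "\<And>n. x n \<in> C"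
    and near: "\<And>n q. q \<in> fixed_points C S \<Longrightarrow> norm (x n - x0) \<le> norm (q - x0)"
    and approx: "(\<lambda>n. x n - S (x n)) \<longlonglongrightarrow> 0"
  shows "x \<longlonglongrightarrow> metric_projection (fixed_points C S) x0"
proof -
  obtain W w where WC: "\<And>k. W k \<in> C"
    and W: "\<And>k. W k - S (W k) = inverse (real (Suc k)) *\<^sub>R (x0 - W k)"
    and lim: "W \<longlonglongrightarrow> w" and w: "w \<in> fixed_points C S"
    and w_proj: "\<And>q. q \<in> fixed_points C S \<Longrightarrow>
      (norm (q - w))\<^sup>2 \<le> (norm (q - x0))\<^sup>2 - (norm (w - x0))\<^sup>2"
    using Browder_approximants_converge[OF assms(1-5) nonexp] by blast
  have "x \<longlonglongrightarrow> w"
  proof (rule LIMSEQ_I)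
    fix e :: real assume "e > 0"
    have "(\<lambda>k. (norm (w - x0))\<^sup>2 - (norm (W k - x0))\<^sup>2) \<longlonglongrightarrow> (norm (w - x0))\<^sup>2 - (norm (w - x0))\<^sup>2"
      by (intro tendsto_intros lim)
    then have "\<forall>\<^sub>F k in sequentially. (norm (w - x0))\<^sup>2 - (norm (W k - x0))\<^sup>2 < (e / 2)\<^sup>2"
      by (rule order_tendstoD(2)) (use \<open>e > 0\<close> in simp)
    moreover have "\<forall>\<^sub>F k in sequentially. dist (W k) w < e / 2"
      by (rule tendstoD[OF lim]) (use \<open>e > 0\<close> in simp)
    ultimately obtain k where k: "(norm (w - x0))\<^sup>2 - (norm (W k - x0))\<^sup>2 < (e / 2)\<^sup>2"
      "dist (W k) w < e / 2"
      using eventually_happens[OF eventually_conj] by fastforce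
    \<comment> \<open>A bound on the distances to \<open>W k\<close> that does not depend on \<open>n\<close>.\<close>
    define B where "B = norm (w - x0) + norm (W k - x0)"
    have B: "norm (x n - W k) \<le> B" for n
    proof -
      have "norm (x n - W k) \<le> norm (x n - x0) + norm (W k - x0)"
        by (metis diff_diff_eq2 diff_add_cancel norm_triangle_ineq4 diff_add_eq)
      then show ?thesis using near[OF w, of n] by (simp add: B_def)
    qed
    have dist_W: "(norm (x n - W k))\<^sup>2 \<le> (norm (w - x0))\<^sup>2 - (norm (W k - x0))\<^sup>2
        + 2 * real (Suc k) * (norm (x n - S (x n)) * B)" for n
    proof -
      have "(norm (x n - W k))\<^sup>2 \<le> (norm (x n - x0))\<^sup>2 - (norm (W k - x0))\<^sup>2
          + 2 / inverse (real (Suc k)) * (norm (x n - S (x n)) * norm (x n - W k))"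
        by (rule approximate_fixed_point_distance[OF nonexp[OF xC WC] _ W]) simp
      moreover have "(norm (x n - x0))\<^sup>2 \<le> (norm (w - x0))\<^sup>2"
        using near[OF w] by (simp add: power_mono)
      moreover have "2 / inverse (real (Suc k)) * (norm (x n - S (x n)) * norm (x n - W k))
          \<le> 2 * real (Suc k) * (norm (x n - S (x n)) * B)"
        unfolding divide_inverse inverse_inverse_eq
        by (intro mult_left_mono B) auto
      ultimately show ?thesis by linarith
    qed
    have "(\<lambda>n. (norm (w - x0))\<^sup>2 - (norm (W k - x0))\<^sup>2
        + 2 * real (Suc k) * (norm (x n - S (x n)) * B))
      \<longlonglongrightarrow> (norm (w - x0))\<^sup>2 - (norm (W k - x0))\<^sup>2 + 2 * real (Suc k) * (norm (0::'a) * B)"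
      by (intro tendsto_intros approx)
    then have "\<forall>\<^sub>F n in sequentially. (norm (w - x0))\<^sup>2 - (norm (W k - x0))\<^sup>2
        + 2 * real (Suc k) * (norm (x n - S (x n)) * B) < (e / 2)\<^sup>2"
      by (rule order_tendstoD(2)) (use k in simp)
    then obtain N where N: "\<And>n. n \<ge> N \<Longrightarrow> (norm (w - x0))\<^sup>2 - (norm (W k - x0))\<^sup>2
        + 2 * real (Suc k) * (norm (x n - S (x n)) * B) < (e / 2)\<^sup>2"
      unfolding eventually_sequentially by blast
    have "norm (x n - w) < e" if "n \<ge> N" for n
    proof -
      have "(norm (x n - W k))\<^sup>2 < (e / 2)\<^sup>2" using dist_W[of n] N[OF that] by linarith
      then have "norm (x n - W k) < e / 2"
        by (rule power2_less_imp_less) (use \<open>e > 0\<close> in simp)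
      moreover have "norm (x n - w) \<le> norm (x n - W k) + norm (W k - w)"
        by (metis diff_add_cancel add_diff_eq norm_triangle_ineq)
      ultimately show ?thesis using k(2) by (simp add: dist_norm)
    qed
    then show "\<exists>N. \<forall>n\<ge>N. norm (x n - w) < e" by blast
  qed
  then show ?thesis using metric_projection_eqI[OF w w_proj] by simp
qed

section \<open>Convergence of the hybrid projection method\<close>

theorem theorem6p4:
  fixes C :: "'a::{real_inner, complete_space} set"
    and T :: "'a \<Rightarrow> 'a"
    and \<kappa> L a :: real
    and \<alpha> \<beta> :: "nat \<Rightarrow> real"
    and x0 :: 'a
    and x v y :: "nat \<Rightarrow> 'a"
    and C' C'' Cn Cstar Q :: "nat \<Rightarrow> 'a set"
  assumes "C \<noteq> {}" and "closed C" and "convex C"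
    and "T ` C \<subseteq> C"
    and "0 \<le> \<kappa>" and "\<kappa> < 1"
    and "strict_pseudo_contraction_on \<kappa> C T"
    and "fixed_points C T \<noteq> {}"
    and "\<forall>p\<in>C. \<forall>q\<in>C. norm (T p - T q) \<le> L * norm (p - q)"
    and "\<forall>n. \<alpha> n \<in> {0..1}" and "\<forall>n. \<beta> n \<in> {0..1}"
    and "0 < a" and "\<forall>n. a \<le> \<alpha> n \<and> \<alpha> n \<le> 1"
    and "\<forall>n. 0 \<le> \<beta> n \<and> \<beta> n \<le> \<kappa> * \<alpha> n + (1 - \<kappa>)"
    and "x0 \<in> C" and "x 0 = x0"
    and "\<forall>n. v n = (1 - \<alpha> n) *\<^sub>R x n + \<alpha> n *\<^sub>R T (x n)"
    and "\<forall>n. y n = (1 - \<beta> n) *\<^sub>R x n + \<beta> n *\<^sub>R T (v n)"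
    and "\<forall>n. C' n = {z \<in> C. (norm (v n - z))\<^sup>2 \<le>
           (norm (x n - z))\<^sup>2 + \<alpha> n * (\<kappa> - (1 - \<alpha> n)) * (norm (x n - T (x n)))\<^sup>2}"
    and "\<forall>n. C'' n = {z \<in> C. (norm (y n - z))\<^sup>2 \<le>
           (norm (x n - z))\<^sup>2
             - \<alpha> n * \<beta> n * (1 - (\<kappa> + 1) * \<alpha> n - \<kappa> * L\<^sup>2 * (\<alpha> n)\<^sup>2)
                 * (norm (x n - T (x n)))\<^sup>2}"
    and "\<forall>n. Cn n = C' n \<inter> C'' n"
    and "\<forall>n. Q n = {z \<in> C. inner (z - x n) (x n - x0) \<ge> 0}"
    and "\<forall>n. closed (Cstar n) \<and> convex (Cstar n)"
    and "\<forall>n. fixed_points C T \<subseteq> Cstar n \<and> Cstar n \<subseteq> Cn n"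
    and "\<forall>n. x (Suc n) = metric_projection (Cstar n \<inter> Q n) x0"
  shows "x \<longlonglongrightarrow> metric_projection (fixed_points C T) x0"
proof -
  let ?F = "fixed_points C T"
  define S where "S = (\<lambda>p. \<kappa> *\<^sub>R p + (1 - \<kappa>) *\<^sub>R T p)"
  have S_disp: "p - S p = (1 - \<kappa>) *\<^sub>R (p - T p)" for p
    by (simp add: S_def algebra_simps)
  have F_eq: "fixed_points C S = ?F"
  proof -
    have "S p = p \<longleftrightarrow> T p = p" for p
    proof -
      have "S p = p \<longleftrightarrow> p - S p = 0" by auto
      also have "\<dots> \<longleftrightarrow> p - T p = 0" unfolding S_disp using \<open>\<kappa> < 1\<close> by simp
      finally show ?thesis by auto
    qed
    then show ?thesis by (simp add: fixed_points_def)
  qed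
  have S_nonexp: "norm (S p - S q) \<le> norm (p - q)" if "p \<in> C" "q \<in> C" for p q
    unfolding S_def
    using averaged_strict_pseudo_contraction_nonexpansive assms(6,7) that by blast
  have S_maps: "S ` C \<subseteq> C"
  proof
    fix r assume "r \<in> S ` C"
    then obtain p where p: "p \<in> C" "r = S p" by blast
    then have "T p \<in> C" using assms(4) by blast
    then show "r \<in> C"
      using convexD[OF assms(3) p(1), of "T p" \<kappa> "1 - \<kappa>"] assms(5,6) p(2) by (simp add: S_def)
  qed
  obtain q where q: "q \<in> ?F" using assms(8) by blast

  have Q_eq: "Q n = C \<inter> {z. inner (x n - x0) z \<ge> inner (x n - x0) (x n)}" for n
  proof -
    have "inner (z - x n) (x n - x0) = inner (x n - x0) z - inner (x n - x0) (x n)" for z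
      by (metis inner_commute inner_diff_right)
    then show ?thesis unfolding assms(22)[rule_format] by auto
  qed
  have Cstar_C: "Cstar n \<subseteq> C" for n
    using assms(24)[rule_format, of n] assms(21)[rule_format, of n] assms(19)[rule_format, of n]
    by blast
  have closed_D: "closed (Cstar n \<inter> Q n)" for n
    unfolding Q_eq using assms(23)[rule_format, of n]
    by (intro closed_Int closed_halfspace_ge assms(2)) simp
  have convex_D: "convex (Cstar n \<inter> Q n)" for n
    unfolding Q_eq using assms(23)[rule_format, of n]
    by (intro convex_Int convex_halfspace_ge assms(3)) simp

  have F_C: "?F \<subseteq> C" by (auto simp: fixed_points_def)
  have F_Cstar: "?F \<subseteq> Cstar n" for n using assms(24) by blast
  \<comment> \<open>The set \<open>Q (Suc n)\<close> contains all of \<open>Cstar n \<inter> Q n\<close>, by the variational inequality for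
    its projection \<open>x (Suc n)\<close>; at \<open>n = 0\<close> the condition is void because \<open>x 0 = x0\<close>.\<close>
  have F_Q: "?F \<subseteq> Q n" for n
  proof (induction n)
    case 0
    show ?case using F_C assms(16) assms(22)[rule_format, of 0] by auto
  next
    case (Suc n)
    then have sub: "?F \<subseteq> Cstar n \<inter> Q n" using F_Cstar by blast
    then have ne: "Cstar n \<inter> Q n \<noteq> {}" using q by blast
    show ?case
    proof
      fix p assume "p \<in> ?F"
      then have "inner (p - x (Suc n)) (x (Suc n) - x0) \<ge> 0"
        unfolding assms(25)[rule_format]
        using metric_projection_characterization(2)[OF closed_D convex_D ne] sub by blast
      then show "p \<in> Q (Suc n)" using \<open>p \<in> ?F\<close> F_C assms(22)[rule_format, of "Suc n"] by auto
    qed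
  qed
  have ne: "Cstar n \<inter> Q n \<noteq> {}" for n using q F_Q[of n] F_Cstar[of n] by blast
  have x_Suc: "x (Suc n) \<in> Cstar n \<inter> Q n" for n
    unfolding assms(25)[rule_format]
    by (rule metric_projection_characterization(1)[OF closed_D convex_D ne])
  have xC: "x n \<in> C" for n
    by (cases n) (use x_Suc Cstar_C assms(15,16) in blast)+

  \<comment> \<open>The definition of \<open>Q n\<close> is the variational inequality saying that \<open>x n\<close> is the point of \<open>Q n\<close>
    nearest to \<open>x0\<close>.\<close>
  have Q_dist: "(norm (z - x n))\<^sup>2 \<le> (norm (z - x0))\<^sup>2 - (norm (x n - x0))\<^sup>2" if "z \<in> Q n" for z n
  proof -
    have "inner (z - x n) (x n - x0) \<ge> 0" using that assms(22)[rule_format, of n] by simp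
    then show ?thesis using norm_diff_square_via[of z "x n" x0] by simp
  qed
  have near_sq: "(norm (x n - x0))\<^sup>2 \<le> (norm (p - x0))\<^sup>2" if "p \<in> ?F" for n p
    using order_trans[OF zero_le_power2 Q_dist[of p n]] F_Q[of n] that by auto
  then have near: "norm (x n - x0) \<le> norm (p - x0)" if "p \<in> ?F" for n p
    using that by (simp add: power2_le_iff_abs_le)

  have step_sq: "(norm (x (Suc n) - x n))\<^sup>2 \<le> (norm (x (Suc n) - x0))\<^sup>2 - (norm (x n - x0))\<^sup>2" for n
    using Q_dist x_Suc by blast
  have "incseq (\<lambda>n. (norm (x n - x0))\<^sup>2)"
    using order_trans[OF zero_le_power2 step_sq] by (intro incseq_SucI) simp
  then obtain l where l: "(\<lambda>n. (norm (x n - x0))\<^sup>2) \<longlonglongrightarrow> l"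
    using incseq_convergent near_sq[OF q] by blast
  have "(\<lambda>n. (norm (x (Suc n) - x0))\<^sup>2 - (norm (x n - x0))\<^sup>2) \<longlonglongrightarrow> l - l"
    by (intro tendsto_diff l LIMSEQ_Suc[OF l])
  then have "(\<lambda>n. (norm (x (Suc n) - x0))\<^sup>2 - (norm (x n - x0))\<^sup>2) \<longlonglongrightarrow> 0" by simp
  then have "(\<lambda>n. (norm (x (Suc n) - x n))\<^sup>2) \<longlonglongrightarrow> 0"
    by (rule Lim_null_comparison[rotated]) (use step_sq in auto)
  then have step: "(\<lambda>n. norm (x (Suc n) - x n)) \<longlonglongrightarrow> 0"
    using tendsto_real_sqrt by fastforce

  have S_small: "norm (x n - S (x n)) \<le> 2 * norm (x (Suc n) - x n)" for n
  proof -
    define d u where "d = x n - T (x n)" and "u = x n - x (Suc n)"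
    have \<alpha>: "\<alpha> n > 0" using assms(12,13) by (meson less_le_trans)
    \<comment> \<open>The point \<open>v n\<close> is \<open>x n\<close> shifted by \<open>- \<alpha> n d\<close>, so in the inequality defining \<open>C' n\<close> the terms
      \<open>(\<alpha> n)\<^sup>2 * norm d ^ 2\<close> cancel and a factor \<open>\<alpha> n > 0\<close> can be divided out.\<close>
    have v: "v n - x (Suc n) = u - \<alpha> n *\<^sub>R d"
      unfolding assms(17)[rule_format] by (simp add: u_def d_def algebra_simps)
    have "x (Suc n) \<in> C' n"
      using x_Suc[of n] assms(21)[rule_format, of n] assms(24)[rule_format, of n] by blast
    then have "(norm (u - \<alpha> n *\<^sub>R d))\<^sup>2 \<le> (norm u)\<^sup>2 + \<alpha> n * (\<kappa> - (1 - \<alpha> n)) * (norm d)\<^sup>2"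
      using assms(19)[rule_format, of n] unfolding v[symmetric] by (simp add: u_def d_def)
    then have "\<alpha> n * ((1 - \<kappa>) * (norm d)\<^sup>2) \<le> \<alpha> n * (2 * inner d u)"
      unfolding norm_diff_scaleR_square
      by (simp add: algebra_simps power2_eq_square inner_commute)
    then have "(1 - \<kappa>) * (norm d)\<^sup>2 \<le> 2 * inner d u" using \<alpha> by simp
    also have "\<dots> \<le> 2 * (norm d * norm u)" using norm_cauchy_schwarz[of d u] by simp
    finally have "norm d * ((1 - \<kappa>) * norm d) \<le> norm d * (2 * norm u)"
      by (simp add: power2_eq_square algebra_simps)
    then have "(1 - \<kappa>) * norm d \<le> 2 * norm u"
      by (cases "d = 0") (auto simp: mult_le_cancel_left)
    then show ?thesis
      using \<open>\<kappa> < 1\<close> by (simp add: S_disp d_def u_def norm_minus_commute)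
  qed
  have "(\<lambda>n. 2 * norm (x (Suc n) - x n)) \<longlonglongrightarrow> 0"
    using tendsto_mult_left[OF step, of 2] by simp
  then have "(\<lambda>n. x n - S (x n)) \<longlonglongrightarrow> 0"
    by (rule Lim_null_comparison[rotated]) (use S_small in auto)
  then have "x \<longlonglongrightarrow> metric_projection (fixed_points C S) x0"
    by (intro approximate_fixed_points_converge_to_projection[OF assms(2,3) S_maps assms(15)]
        S_nonexp xC) (use q near F_eq in auto)
  then show ?thesis by (simp only: F_eq)
qed

end
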